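(* Let $\mathcal{A}$ be a linearly ordered alphabet of cardinality at least $4$. For every integer $n \geqslant 3$, there exists a word $w \in \mathcal{A}^{2^n-1}$ on which the IS-algorithm performs $n-2$ recursive calls, and such that \[|\mathsf{is}^k(w)|+1 = 2^{-k} (|w|+1)\] for all $k \in \{0,1,\ldots,n-2\}$.
   Context: Words are indexed from $0$: $w = w_0 w_1 \cdots w_{|w|-1}$, and $w_{i \cdots j} = w_i w_{i+1} \cdots w_j$. A sentinel letter $\$ \notin \mathcal{A}$ is declared smaller than every letter of $\mathcal{A}$, and one sets $w_{|w|} = \$$. An integer $i \leqslant |w|-1$ is $w$-non-decreasing if there exists $j$ with $i+1 \leqslant j \leqslant |w|-1$ and $w_i = w_{i+1} = \cdots = w_{j-1} < w_j$; it is $w$-locally minimal if moreover $i \geqslant 1$ and $w_{i-1} > w_i$. If $i_0 < i_1 < \cdots < i_{k-1}$ are the $w$-locally minimal integers and $i_k = |w|$, the unimodal factors of $w$ are $w_{i_0 \cdots i_1}, w_{i_1 \cdots i_2}, \ldots, w_{i_{k-1} \cdots i_k}$ (the last one ends with $\$$). The expanded IS-reduction $\mathsf{eis}(w)$ is the length-$k$ word, over the alphabet $\mathcal{A}^+\cdot(\varepsilon+\$)$ ordered lexicographically, whose letters are these unimodal factors in order. If $\mathsf{eis}(w)$ has $\ell$ distinct letters, $\mathsf{is}(w)$ is the word over $\{0,1,\ldots,\ell-1\}$ obtained by replacing each letter of $\mathsf{eis}(w)$ by its rank (starting from $0$, increasing with the lexicographic order) among these distinct letters. Set $\mathsf{is}^0(w)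 = w$ and $\mathsf{is}^{k+1}(w) = \mathsf{is}(\mathsf{is}^k(w))$. The IS-algorithm computes the suffix array of its input word $v$ by computing $\mathsf{is}(v)$ and then computing the suffix array of $\mathsf{is}(v)$, directly if the letters of $\mathsf{is}(v)$ are pairwise distinct, and by a recursive call of the IS-algorithm on $\mathsf{is}(v)$ otherwise (it then deduces the suffix array of $v$). *)

theory Defs
  imports Complex_Main "HOL-Library.Option_ord" "HOL-Library.List_Lexorder"
begin

text \<open>
  The sentinel is \<^term>\<open>None\<close>, so that it lies below every letter \<^term>\<open>Some a\<close>, and factors
  that may end with the sentinel are words of type \<^typ>\<open>'a option list\<close>, ordered lexicographically.
\<close>

definition letter :: "'a list \<Rightarrow> nat \<Rightarrow> 'a option" where
  "letter w i = (if i < length w then Some (w ! i) else None)"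

definition factor :: "'a list \<Rightarrow> nat \<Rightarrow> nat \<Rightarrow> 'a option list" where
  "factor w i j = map (letter w) [i..<Suc j]"

definition non_decreasing :: "'a::linorder list \<Rightarrow> nat \<Rightarrow> bool" where
  "non_decreasing w i \<longleftrightarrow> i < length w \<and>
     (\<exists>j. i + 1 \<le> j \<and> j < length w \<and> (\<forall>m\<in>{i..<j}. w ! m = w ! i) \<and> w ! (j - 1) < w ! j)"

definition locally_minimal :: "'a::linorder list \<Rightarrow> nat \<Rightarrow> bool" where
  "locally_minimal w i \<longleftrightarrow> non_decreasing w i \<and> 1 \<le> i \<and> w ! (i - 1) > w ! i"

definition local_minima :: "'a::linorder list \<Rightarrow> nat list" where
  "local_minima w = filter (locally_minimal w) [0..<length w]"

definition eis :: "'a::linorder list \<Rightarrow> 'a option list list" where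
  "eis w = (let p = local_minima w @ [length w]
            in map (\<lambda>m. factor w (p ! m) (p ! Suc m)) [0..<length (local_minima w)])"

definition is_red :: "'a::linorder list \<Rightarrow> nat list" where
  "is_red w = map (\<lambda>x. card {y \<in> set (eis w). y < x}) (eis w)"

text \<open>
  The input word and its iterated reductions have different types, so they are collected in the
  sum type \<^typ>\<open>'a list + nat list\<close>: only the input word itself is a left summand.
\<close>

definition is_step :: "'a::linorder list + nat list \<Rightarrow> nat list" where
  "is_step v = (case v of Inl w \<Rightarrow> is_red w | Inr u \<Rightarrow> is_red u)"

definition word_length :: "'a list + nat list \<Rightarrow> nat" where
  "word_length v = (case v of Inl w \<Rightarrow> length w | Inr u \<Rightarrow> length u)"

primrec is_pow :: "nat \<Rightarrow> 'a::linorder list \<Rightarrow> 'a list + nat list" where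
  "is_pow 0 w = Inl w"
| "is_pow (Suc k) w = Inr (is_step (is_pow k w))"

lemma length_is_red_less:
  assumes "w \<noteq> []"
  shows "length (is_red w) < length w"
proof -
  have "filter (locally_minimal w) [0..<length w] = filter (locally_minimal w) [1..<length w]"
    using assms by (subst upt_conv_Cons) (auto simp: locally_minimal_def)
  moreover have "length (filter (locally_minimal w) [1..<length w]) \<le> length [1..<length w]"
    by (rule length_filter_le)
  ultimately have "length (local_minima w) \<le> length w - 1"
    by (simp add: local_minima_def)
  moreover have "length (is_red w) = length (local_minima w)"
    by (simp add: is_red_def eis_def Let_def)
  moreover have "length w > 0"
    using assms by simp
  ultimately show ?thesis
    by linarith
qed

lemma is_red_Nil [simp]: "is_red [] = []"
  by (simp add: is_red_def eis_def local_minima_def)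

lemma word_length_is_step_less:
  assumes "\<not> distinct (is_step v)"
  shows "length (is_step v) < word_length v"
proof (cases v)
  case (Inl w)
  then have "w \<noteq> []" using assms by (auto simp: is_step_def)
  then show ?thesis using Inl length_is_red_less[of w] by (simp add: is_step_def word_length_def)
next
  case (Inr u)
  then have "u \<noteq> []" using assms by (auto simp: is_step_def)
  then show ?thesis using Inr length_is_red_less[of u] by (simp add: is_step_def word_length_def)
qed

text \<open>
  The number of recursive calls performed by the IS-algorithm on a given input; the initial call
  itself is not counted.
\<close>

function rec_calls :: "'a::linorder list + nat list \<Rightarrow> nat" where
  "rec_calls v =
     (if distinct (is_step v) then 0 else Suc (rec_calls (Inr (is_step v))))"
  by auto
termination
  by (relation "measure word_length")
     (auto simp: word_length_def dest: word_length_is_step_less)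

declare rec_calls.simps [simp del]

definition is_algorithm_calls :: "'a::linorder list \<Rightarrow> nat" where
  "is_algorithm_calls w = rec_calls (Inl w)"

end

theory Submission
  imports Defs
begin

text \<open>
  A word of length \<open>2 m + 1\<close> reduces to a word of length \<open>m\<close> exactly when it is alternating,
  \<open>w\<^sub>0 > w\<^sub>1 < w\<^sub>2 > \<dots> < w\<^sub>2\<^sub>m\<close>, and its unimodal factors then have length three. Such a reduction
  can be inverted inside one class of words: if the valleys of \<open>u\<close> lie in \<open>{0, 1}\<close>, its peaks in
  \<open>{2, 4}\<close>, and it ends with the peak \<open>3\<close>, then prefixing \<open>2\<close> to the image of \<open>u\<close> under the
  morphism \<open>0 \<mapsto> 02, 1 \<mapsto> 04, 2 \<mapsto> 12, 3 \<mapsto> 13, 4 \<mapsto> 14\<close> gives a word of the same class. Its factors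
  are \<open>021 < 041 < 120 < 13$ < 140\<close>, so it reduces to \<open>u\<close> up to an order-preserving
  relabelling. Iterating from \<open>2020203\<close>, which reduces to \<open>001\<close>, gives the words over five letters.
  In the last step \<open>3\<close> and \<open>4\<close> may share their peak letter, because the sentinel still makes
  \<open>13$ < 130\<close>; this brings the alphabet down to four letters.
\<close>

section \<open>Invariance under relabelling\<close>

definition rank_word :: "'a::linorder list \<Rightarrow> nat list" where
  "rank_word u = map (\<lambda>x. card {y \<in> set u. y < x}) u"

lemma length_rank_word [simp]: "length (rank_word u) = length u"
  by (simp add: rank_word_def)

lemma is_red_eq_rank_word: "is_red w = rank_word (eis w)"
  by (simp add: is_red_def rank_word_def)

lemma strict_mono_on_rank:
  fixes S :: "'a::linorder set"
  assumes "finite S"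
  shows "strict_mono_on S (\<lambda>x. card {y \<in> S. y < x})"
proof (rule strict_mono_onI)
  fix r s assume "r \<in> S" "s \<in> S" "r < s"
  then have "{y \<in> S. y < r} \<subset> {y \<in> S. y < s}"
    by auto
  then show "card {y \<in> S. y < r} < card {y \<in> S. y < s}"
    using assms by (intro psubset_card_mono) auto
qed

lemma distinct_rank_word [simp]: "distinct (rank_word u) = distinct u"
  using strict_mono_on_imp_inj_on[OF strict_mono_on_rank[of "set u"]]
  by (simp add: rank_word_def distinct_map)

lemma rank_word_map:
  fixes f :: "'a::linorder \<Rightarrow> 'b::linorder"
  assumes "strict_mono_on (set u) f"
  shows "rank_word (map f u) = rank_word u"
proof -
  have "card {y \<in> f ` set u. y < f x} = card {y \<in> set u. y < x}" if "x \<in> set u" for x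
  proof -
    have "{y \<in> f ` set u. y < f x} = f ` {y \<in> set u. y < x}"
      using that assms by (auto simp: strict_mono_on_less)
    moreover have "inj_on f {y \<in> set u. y < x}"
      using strict_mono_on_imp_inj_on[OF assms] by (rule inj_on_subset) auto
    ultimately show ?thesis
      by (simp add: card_image)
  qed
  then show ?thesis
    by (simp add: rank_word_def)
qed

lemma map_less_map_lists:
  fixes g :: "'a::linorder \<Rightarrow> 'b::linorder"
  assumes "strict_mono_on S g" "set xs \<subseteq> S" "set ys \<subseteq> S" "xs < ys"
  shows "map g xs < map g ys"
  using assms(2-4)
proof (induction xs arbitrary: ys)
  case Nil
  then show ?case by (cases ys) auto
next
  case (Cons x xs)
  then obtain y zs where "ys = y # zs"
    by (cases ys) auto
  with Cons show ?case
    using strict_mono_onD[OF assms(1), of x y] by auto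
qed

lemma local_minima_map:
  fixes f :: "'a::linorder \<Rightarrow> 'b::linorder"
  assumes "strict_mono_on (set w) f"
  shows "local_minima (map f w) = local_minima w"
proof -
  have less: "f (w ! i) < f (w ! j) \<longleftrightarrow> w ! i < w ! j" if "i < length w" "j < length w" for i j
    using that assms by (simp add: strict_mono_on_less)
  have eq: "f (w ! i) = f (w ! j) \<longleftrightarrow> w ! i = w ! j" if "i < length w" "j < length w" for i j
    using that strict_mono_on_imp_inj_on[OF assms] by (simp add: inj_on_eq_iff)
  have "non_decreasing (map f w) i = non_decreasing w i" for i
  proof -
    have "(\<forall>m\<in>{i..<j}. map f w ! m = map f w ! i) \<longleftrightarrow> (\<forall>m\<in>{i..<j}. w ! m = w ! i)"
      if "i < length w" "j < length w" for j
      using that by (intro ball_cong refl) (simp add: eq)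
    moreover have "map f w ! (j - 1) < map f w ! j \<longleftrightarrow> w ! (j - 1) < w ! j"
      if "j < length w" for j
      using that by (simp add: less)
    ultimately show ?thesis
      unfolding non_decreasing_def length_map by metis
  qed
  then have "locally_minimal (map f w) i = locally_minimal w i" if "i < length w" for i
    using that by (auto simp: locally_minimal_def less)
  then show ?thesis
    unfolding local_minima_def by (auto intro: filter_cong)
qed

lemma is_red_map:
  fixes f :: "'a::linorder \<Rightarrow> 'b::linorder"
  assumes "strict_mono_on (set w) f"
  shows "is_red (map f w) = is_red w"
proof -
  let ?S = "insert None (Some ` set w)"
  have "letter (map f w) = map_option f \<circ> letter w"
    by (auto simp: letter_def)
  then have eis: "eis (map f w) = map (map (map_option f)) (eis w)"
    by (simp add: eis_def Let_def factor_def local_minima_map[OF assms])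
  \<comment> \<open>\<open>map_option f\<close> fixes the sentinel \<open>None\<close>, which stays
    below every letter, so factors ending with it are compared as before.\<close>
  have mono: "strict_mono_on ?S (map_option f)"
    using assms by (auto simp: strict_mono_on_def)
  have letters: "set x \<subseteq> ?S" if "x \<in> set (eis w)" for x
    using that by (auto simp: eis_def Let_def factor_def letter_def)
  have "strict_mono_on (set (eis w)) (map (map_option f))"
    by (rule strict_mono_onI) (rule map_less_map_lists[OF mono letters letters])
  then show ?thesis
    by (simp add: is_red_eq_rank_word eis rank_word_map)
qed

text \<open>Actual iterates are words of ranks; this allows each of them to be replaced by a
  convenient word with the same letter order.\<close>

lemma is_red_rank_word: "is_red (rank_word u) = is_red u"
  unfolding rank_word_def by (rule is_red_map) (rule strict_mono_on_rank, simp)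


section \<open>Alternating words\<close>

definition alternating :: "'a::linorder list \<Rightarrow> nat \<Rightarrow> bool" where
  "alternating w m \<longleftrightarrow> length w = 2 * m + 1 \<and>
     (\<forall>i<m. w ! (2 * i + 1) < w ! (2 * i) \<and> w ! (2 * i + 1) < w ! (2 * i + 2))"

lemma nat_cases_0_odd_even:
  obtains "j = 0" | i where "j = 2 * i + 1" | i where "j = 2 * i + (2::nat)"
proof (cases "odd j")
  case True
  then show thesis using that(2) by (auto elim: oddE)
next
  case False
  then obtain k where "j = 2 * k" by (auto elim: evenE)
  then show thesis using that(1,3) by (cases k) auto
qed

lemma local_minima_alternating:
  assumes "alternating w m"
  shows "local_minima w = map (\<lambda>i. 2 * i + 1) [0..<m]"
proof -
  have down: "w ! (2 * i + 1) < w ! (2 * i)" and up: "w ! (2 * i + 1) < w ! (2 * i + 2)"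
    if "i < m" for i
    using assms that by (auto simp: alternating_def)
  have len: "length w = 2 * m + 1"
    using assms by (simp add: alternating_def)
  have "locally_minimal w j = odd j" if j: "j < length w" for j
  proof (cases j rule: nat_cases_0_odd_even)
    case 1
    then show ?thesis by (simp add: locally_minimal_def)
  next
    case (2 i)
    then have "i < m" using j len by simp
    then have "non_decreasing w j"
      unfolding non_decreasing_def using up[of i] 2 len
      by (intro conjI exI[of _ "j + 1"]) auto
    then show ?thesis
      using down[OF \<open>i < m\<close>] 2 by (simp add: locally_minimal_def)
  next
    case (3 i)
    then have "w ! (j - 1) < w ! j" using up[of i] j len by simp
    then show ?thesis using 3 by (auto simp: locally_minimal_def)
  qed
  then have "local_minima w = filter odd [0..<length w]"
    unfolding local_minima_def by (auto intro: filter_cong)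
  also have "\<dots> = map (\<lambda>i. 2 * i + 1) [0..<m]"
    unfolding len by (induction m) auto
  finally show ?thesis .
qed

lemma eis_alternating:
  assumes "alternating w m"
  shows "eis w =
    map (\<lambda>i. [letter w (2 * i + 1), letter w (2 * i + 2), letter w (2 * i + 3)]) [0..<m]"
proof -
  \<comment> \<open>The appended end \<open>length w\<close> is \<open>2 * m + 1\<close>, so it
    continues the progression of valleys and the last factor needs no separate treatment.\<close>
  have p: "local_minima w @ [length w] = map (\<lambda>i. 2 * i + 1) [0..<Suc m]"
    using assms local_minima_alternating[OF assms] by (simp add: alternating_def)
  have "(local_minima w @ [length w]) ! i = 2 * i + 1" if "i \<le> m" for i
    unfolding p using that by (simp del: upt_Suc)
  moreover have "[2 * i + 1..<Suc (2 * Suc i + 1)] = [2 * i + 1, 2 * i + 2, 2 * i + 3]" for i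
    by (simp add: upt_rec)
  ultimately show ?thesis
    using local_minima_alternating[OF assms] by (simp add: eis_def Let_def factor_def del: upt_Suc)
qed


section \<open>Inverting the reduction\<close>

definition tame :: "nat list \<Rightarrow> bool" where
  "tame u \<longleftrightarrow> odd (length u) \<and>
     (\<forall>i<length u. u ! i \<in> (if odd i then {0, 1} else if Suc i = length u then {3} else {2, 4}))"

definition valley :: "'a \<Rightarrow> 'a \<Rightarrow> nat \<Rightarrow> 'a" where
  "valley a b x = (if x < 2 then a else b)"

definition peak :: "'a \<Rightarrow> 'a \<Rightarrow> 'a \<Rightarrow> nat \<Rightarrow> 'a" where
  "peak c e d x = (if x = 0 \<or> x = 2 then c else if x = 3 then e else d)"

text \<open>The morphism with its letters as parameters, preceded by \<open>c\<close>: the values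
  \<open>0 1 2 3 4\<close> serve the iteration, and \<open>a b c d d\<close> the last step over four
  letters.\<close>

definition expand :: "'a \<Rightarrow> 'a \<Rightarrow> 'a \<Rightarrow> 'a \<Rightarrow> 'a \<Rightarrow> nat list \<Rightarrow> 'a list" where
  "expand a b c e d u = map (\<lambda>j. if j = 0 then c
     else if odd j then valley a b (u ! (j div 2)) else peak c e d (u ! (j div 2 - 1)))
     [0..<2 * length u + 1]"

lemma length_expand [simp]: "length (expand a b c e d u) = 2 * length u + 1"
  by (simp add: expand_def)

lemma nth_expand:
  shows "expand a b c e d u ! 0 = c"
    and "i < length u \<Longrightarrow> expand a b c e d u ! (2 * i + 1) = valley a b (u ! i)"
    and "i < length u \<Longrightarrow> expand a b c e d u ! (2 * i + 2) = peak c e d (u ! i)"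
  by (simp_all add: expand_def del: upt_Suc)

lemma set_expand: "set (expand a b c e d u) \<subseteq> {a, b, c, e, d}"
  by (auto simp: expand_def valley_def peak_def)

lemma alternating_expand:
  fixes a b c e d :: "'a::linorder"
  assumes "a < b" "b < c" "c < e" "e \<le> d"
  shows "alternating (expand a b c e d u) (length u)"
proof -
  have less: "valley a b x < c" "valley a b x < peak c e d y" for x y
    using assms by (auto simp: valley_def peak_def)
  have "valley a b (u ! i) < expand a b c e d u ! (2 * i)" if "i < length u" for i
    \<comment> \<open>The left neighbour of a valley is the prefix \<open>c\<close> if
      \<open>i = 0\<close>, and the previous peak otherwise.\<close>
    using that nth_expand(3)[of "i - 1" u a b c e d] by (cases i) (simp_all add: nth_expand(1) less)
  then show ?thesis
    using nth_expand(2,3)[of _ u a b c e d] less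
    by (simp add: alternating_def del: add_2_eq_Suc' One_nat_def)
qed

lemma is_red_expand:
  fixes a b c e d :: "'a::linorder"
  assumes "a < b" "b < c" "c < e" "e \<le> d" and "tame u"
  shows "is_red (expand a b c e d u) = rank_word u"
proof -
  let ?w = "expand a b c e d u"
  \<comment> \<open>The third entry depends on \<open>x\<close> alone because \<open>u\<close>
    alternates: a letter below 2 precedes a peak, whose image starts with \<open>b\<close>; 2 and 4
    precede a valley, whose image starts with \<open>a\<close>; 3 is last and meets the
    sentinel.\<close>
  define F where "F x = [Some (valley a b x), Some (peak c e d x),
    if x = 3 then None else Some (if x < 2 then b else a)]" for x
  have u: "u ! i \<in> (if odd i then {0, 1} else if Suc i = length u then {3} else {2, 4})"
    if "i < length u" for i
    using assms(5) that by (simp add: tame_def)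
  have "odd (length u)"
    using assms(5) by (simp add: tame_def)
  have F: "[letter ?w (2 * i + 1), letter ?w (2 * i + 2), letter ?w (2 * i + 3)] = F (u ! i)"
    if i: "i < length u" for i
  proof -
    have "letter ?w (2 * i + 3) =
      (if u ! i = 3 then None else Some (if u ! i < 2 then b else a))"
    proof (cases "Suc i = length u")
      case True
      then have "even i" using \<open>odd (length u)\<close> by (metis even_Suc)
      with True show ?thesis using u[OF i] by (simp add: letter_def)
    next
      case False
      then have "Suc i < length u" using i by simp
      with False show ?thesis
        using u[OF i] u[OF \<open>Suc i < length u\<close>] nth_expand(2)[of "Suc i" u a b c e d]
        by (auto simp: letter_def valley_def numeral_3_eq_3 split: if_splits)
    qed
    moreover have "letter ?w (2 * i + 1) = Some (valley a b (u ! i))"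
      "letter ?w (2 * i + 2) = Some (peak c e d (u ! i))"
      using i nth_expand(2,3)[OF i, of a b c e d] by (simp_all add: letter_def)
    ultimately show ?thesis
      by (simp add: F_def)
  qed
  have "eis ?w = map (\<lambda>i. F (u ! i)) [0..<length u]"
    using F by (simp add: eis_alternating[OF alternating_expand[OF assms(1-4)]])
  also have "\<dots> = map F u"
    by (rule nth_equalityI) simp_all
  finally have "eis ?w = map F u" .
  \<comment> \<open>The first two entries decide every comparison except that of 3 with 4 when
    \<open>e = d\<close>; there \<open>None\<close> lies below \<open>Some a\<close>.\<close>
  moreover have "strict_mono_on (set u) F"
  proof (rule strict_mono_onI)
    fix x y assume "x \<in> set u" "y \<in> set u" "x < y"
    moreover have "z \<in> {0, 1, 2, 3, 4}" if "z \<in> set u" for z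
      using that u by (fastforce simp: in_set_conv_nth split: if_splits)
    ultimately have "y \<le> 4" "x < y"
      by fastforce+
    then have "x = 0 \<or> x = 1 \<or> x = 2 \<or> x = 3" "y = 1 \<or> y = 2 \<or> y = 3 \<or> y = 4"
      by linarith+
    with \<open>x < y\<close> show "F x < F y"
      using assms(1-4) by (auto simp: F_def valley_def peak_def)
  qed
  ultimately show ?thesis
    by (simp add: is_red_eq_rank_word rank_word_map)
qed

text \<open>The peak 3 arises only from the letter 3, which \<open>u\<close> has only at its end;
  all other peaks are 2 or 4.\<close>

lemma tame_expand:
  assumes "tame u"
  shows "tame (expand 0 1 2 3 4 u)" (is "tame ?w")
  unfolding tame_def
proof (intro conjI allI impI)
  have "odd (length u)"
    and u: "\<And>i. i < length u \<Longrightarrow>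
      u ! i \<in> (if odd i then {0, 1} else if Suc i = length u then {3} else {2, 4})"
    using assms by (auto simp: tame_def)
  fix j assume j: "j < length ?w"
  show "?w ! j \<in> (if odd j then {0, 1} else if Suc j = length ?w then {3} else {2, 4})"
  proof (cases j rule: nat_cases_0_odd_even)
    case 1
    \<comment> \<open>Odd length excludes the empty \<open>u\<close>, for which position 0 would be
      last and carry 2 instead of 3.\<close>
    then show ?thesis using \<open>odd (length u)\<close> by (auto simp: nth_expand(1))
  next
    case (2 i)
    then show ?thesis using j nth_expand(2)[of i u "0::nat" 1 2 3 4] by (simp add: valley_def)
  next
    case (3 i)
    then have i: "i < length u" using j by simp
    have "even i" if "Suc i = length u"
      using that \<open>odd (length u)\<close> by (metis even_Suc)
    then show ?thesis
      using u[OF i] 3 nth_expand(3)[OF i, of "0::nat" 1 2 3 4]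
      by (auto simp: peak_def split: if_splits)
  qed
qed simp


section \<open>The iterated preimages\<close>

text \<open>\<open>tower 1\<close> is given separately: \<open>tower 0\<close> is not
  \<open>tame\<close>, and expanding it would end with 4 instead of 3. The factors of
  \<open>tower 1\<close> are \<open>020\<close>, \<open>020\<close> and \<open>03$\<close>.\<close>

fun tower :: "nat \<Rightarrow> nat list" where
  "tower 0 = [0, 0, 1]"
| "tower (Suc 0) = [2, 0, 2, 0, 2, 0, 3]"
| "tower (Suc (Suc k)) = expand 0 1 2 3 4 (tower (Suc k))"

lemma length_tower: "length (tower k) = 2 ^ (k + 2) - 1"
proof (induction k rule: tower.induct)
  case (3 k)
  \<comment> \<open>This bound controls the truncated subtraction in the length formula.\<close>
  moreover have "(1::nat) \<le> 2 ^ k" by simp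
  ultimately show ?case by (simp, linarith)
qed simp_all

lemma tame_tower: "tame (tower (Suc k))"
proof (induction k)
  case 0
  have "i \<in> {0, 1, 2, 3, 4, 5, 6}" if "i < 7" for i :: nat
    using that by auto
  then have all7: "(\<forall>i<7. P i) \<longleftrightarrow> P 0 \<and> P 1 \<and> P 2 \<and> P 3 \<and> P 4 \<and> P 5 \<and> P 6" for P :: "nat \<Rightarrow> bool"
    by (intro iffI allI impI) (simp, fastforce)
  have "length (tower (Suc 0)) = 7" by simp
  then show ?case
    unfolding tame_def by (simp only: all7) simp
next
  case (Suc k)
  then show ?case using tame_expand by simp
qed

lemma is_red_tower: "is_red (tower (Suc k)) = rank_word (tower k)"
proof (cases k)
  case 0
  have "i = 0 \<or> i = 1 \<or> i = 2" if "i < 3" for i :: nat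
    using that by linarith
  then have "alternating (tower (Suc 0)) 3"
    by (fastforce simp: alternating_def)
  then have "eis (tower (Suc 0)) =
      map (\<lambda>x. if x = 0 then [Some 0, Some 2, Some 0] else [Some 0, Some 3, None]) (tower 0)"
    by (simp add: eis_alternating letter_def upt_rec)
  moreover have "strict_mono_on (set (tower 0))
      (\<lambda>x. if x = 0 then [Some 0, Some 2, Some 0] else [Some 0, Some 3, None :: nat option])"
    by (auto simp: strict_mono_on_def)
  ultimately show ?thesis
    unfolding 0 is_red_eq_rank_word by (simp only: rank_word_map)
next
  case (Suc j)
  then show ?thesis
    using is_red_expand[of "0::nat" 1 2 3 4 "tower k"] tame_tower[of j] by simp
qed

text \<open>Beyond the base word, at most five letters fill at least seven positions.\<close>

lemma not_distinct_tower: "\<not> distinct (tower k)"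
proof (cases k)
  case (Suc j)
  have "set (tower k) \<subseteq> {0, 1, 2, 3, 4}"
    using Suc set_expand[of 0 1 2 3 "4::nat"] by (cases j) auto
  then have "card (set (tower k)) \<le> card {0, 1, 2, 3, 4::nat}"
    by (rule card_mono[rotated]) simp
  moreover have "(1::nat) \<le> 2 ^ j" by simp
  then have "length (tower k) \<ge> 7"
    unfolding Suc length_tower by (simp, linarith)
  ultimately show ?thesis
    using distinct_card by fastforce
qed simp

lemma rec_calls_tower: "rec_calls (Inr (rank_word (tower k)) :: 'a::linorder list + nat list) = k"
proof (induction k)
  case 0
  \<comment> \<open>The word \<open>001\<close> never descends, so it has no local minimum; its
    reduction is empty, hence distinct, and the recursion stops.\<close>
  have "is_red (tower 0) = []"
    by (simp add: is_red_def eis_def local_minima_def locally_minimal_def less_Suc_eq upt_rec)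
  then show ?case
    by (subst rec_calls.simps) (simp add: is_step_def is_red_rank_word)
next
  case (Suc k)
  have "is_step (Inr (rank_word (tower (Suc k))) :: 'a list + nat list) = rank_word (tower k)"
    by (simp add: is_step_def is_red_rank_word is_red_tower)
  then show ?case
    using Suc not_distinct_tower[of k] by (subst rec_calls.simps) simp
qed

lemma is_pow_tower:
  assumes "is_red w = rank_word (tower n)" "k \<le> n"
  shows "is_pow (Suc k) w = Inr (rank_word (tower (n - k)))"
  using assms(2)
proof (induction k)
  case 0
  then show ?case by (simp add: is_step_def assms(1))
next
  case (Suc k)
  then have "n - k = Suc (n - Suc k)" by simp
  with Suc show ?case
    by (simp add: is_step_def is_red_rank_word is_red_tower)
qed

section \<open>Passing to an alphabet of four letters\<close>

lemma obtain_four_letters: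
  fixes A :: "'a::linorder set"
  assumes "infinite A \<or> 4 \<le> card A"
  obtains a b c d where "a < b" "b < c" "c < d" "{a, b, c, d} \<subseteq> A"
proof -
  obtain B where B: "B \<subseteq> A" "card B = 4" "finite B"
    using assms infinite_arbitrarily_large[of A 4] obtain_subset_with_card_n[of 4 A] by metis
  define xs where "xs = sorted_list_of_set B"
  have "length xs = 4" "sorted_wrt (<) xs" "set xs = B"
    using B by (simp_all add: xs_def)
  then obtain a b c d where "xs = [a, b, c, d]"
    by (auto simp: length_Suc_conv numeral_eq_Suc)
  with \<open>sorted_wrt (<) xs\<close> \<open>set xs = B\<close> B(1) show thesis
    by (intro that[of a b c d]) auto
qed

lemma tower_preimage_four_letters:
  fixes A :: "'a::linorder set"
  assumes "infinite A \<or> 4 \<le> card A"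
  obtains w where "w \<in> lists A" "length w = 2 ^ (k + 3) - 1" "is_red w = rank_word (tower k)"
proof -
  obtain a b c d where abcd: "a < b" "b < c" "c < d" "{a, b, c, d} \<subseteq> A"
    using obtain_four_letters[OF assms] .
  show thesis
  proof (cases k)
    case 0
    \<comment> \<open>\<open>tower 1\<close> uses only the letters 0, 2 and 3, so a relabelling
      suffices.\<close>
    define f :: "nat \<Rightarrow> 'a" where "f x = (if x = 0 then a else if x = 2 then c else d)" for x
    have "strict_mono_on (set (tower 1)) f"
      using abcd by (auto simp: strict_mono_on_def f_def)
    then show thesis
      using abcd is_red_map[of "tower 1" f] is_red_tower[of 0] 0
      by (intro that[of "map f (tower 1)"]) (simp_all add: f_def)
  next
    case (Suc j)
    \<comment> \<open>For \<open>k > 0\<close>, \<open>tower (Suc k)\<close> is also an expansion of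
      \<open>tower k\<close>, so it has the required length.\<close>
    have "2 * length (tower k) + 1 = 2 ^ (k + 3) - 1"
      using length_tower[of "Suc k"] Suc by (simp add: power_add)
    then show thesis
      using abcd set_expand[of a b c d d "tower k"] is_red_expand[of a b c d d "tower k"]
        tame_tower[of j] Suc
      by (intro that[of "expand a b c d d (tower k)"]) auto
  qed
qed

theorem theorem4:
  fixes A :: "'a::linorder set" and n :: nat
  assumes "infinite A \<or> 4 \<le> card A"
    and "3 \<le> n"
  shows "\<exists>w \<in> lists A. length w = 2 ^ n - 1
    \<and> is_algorithm_calls w = n - 2
    \<and> (\<forall>k \<in> {0..n - 2}.
         real (word_length (is_pow k w)) + 1 = 2 powi (- int k) * (real (length w) + 1))"
proof -
  \<comment> \<open>One reduction takes \<open>w\<close> to \<open>tower m\<close>, of length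
    \<open>2 ^ (m + 2) - 1 = 2 ^ (n - 1) - 1\<close>.\<close>
  define m where "m = n - 3"
  have n: "n = m + 3" using assms(2) by (simp add: m_def)
  obtain w where w: "w \<in> lists A" "length w = 2 ^ n - 1" "is_red w = rank_word (tower m)"
    using tower_preimage_four_letters[OF assms(1)] unfolding n .
  \<comment> \<open>The repeated letters of \<open>tower m\<close> force one call, which in turn
    performs \<open>m\<close> further calls.\<close>
  have "rec_calls (Inl w) = Suc m"
    using w(3) not_distinct_tower[of m] rec_calls_tower[of m, where 'a = 'a]
    by (subst rec_calls.simps) (simp add: is_step_def)
  then have "is_algorithm_calls w = n - 2"
    by (simp add: is_algorithm_calls_def n)
  moreover have "real (word_length (is_pow k w)) + 1 = 2 powi (- int k) * (real (length w) + 1)"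
    if "k \<in> {0..n - 2}" for k
  proof -
    have "word_length (is_pow k w) = 2 ^ (n - k) - 1"
    proof (cases k)
      case 0
      then show ?thesis by (simp add: word_length_def w(2))
    next
      case (Suc j)
      then have "j \<le> m" "m - j + 2 = n - k" using that n by auto
      then show ?thesis
        using Suc is_pow_tower[OF w(3), of j] by (simp add: word_length_def length_tower)
    qed
    then have "real (word_length (is_pow k w)) + 1 = 2 ^ (n - k)"
      by (simp)
    also have "\<dots> = 2 powi (- int k) * 2 ^ n"
      using that by (simp add: power_int_minus power_diff field_simps)
    also have "(2::real) ^ n = real (length w) + 1"
      by (simp add: w(2))
    finally show ?thesis .
  qed
  ultimately show ?thesis
    using w by blast
qed

end
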